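(* Let $1<p<\infty$, let $v,w$ be weight functions on $\mathbb{R}^2$, and let $\phi\in L^1(\mathbb{R}^2)$ be such that $$\mathscr{B}_{\sup}:=\int_{\mathbb{R}^2} \frac{|\phi(t_1,t_2)|}{|t_1t_2|^{2\alpha+2-\frac1p}}\left(\sup_{(y_1,y_2)\in\mathbb{R}^2}\frac{v(t_1y_1,t_2y_2)}{w(y_1,y_2)}\right)^{1/p}dt_1dt_2<\infty .$$ Then the operator $\mathscr{H}_{\alpha,\phi}:L^p_w(\mathbb{R}^2)\to L^p_v(\mathbb{R}^2)$ is bounded and, for every $f\in L^p_w(\mathbb{R}^2)$, $$\|\mathscr{H}_{\alpha,\phi}f\|_{L^p_v(\mathbb{R}^2)}\le \mathscr{B}_{\sup}\,\|f\|_{L^p_w(\mathbb{R}^2)}.$$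
   Context: A weight function is a function which is measurable, positive and finite almost everywhere on its domain. For a weight $v$, $L^p_v(\mathbb{R}^2)$ is the weighted Lebesgue space with norm $\|f\|_{L^p_v(\mathbb{R}^2)}=\left(\int_{\mathbb{R}^2}|f(x_1,x_2)|^p v(x_1,x_2)\,dx_1dx_2\right)^{1/p}$, and similarly for $w$. For a real parameter $\alpha$ and $\phi\in L^1(\mathbb{R}^2)$, the two dimensional Dunkl-Hausdorff operator is $$\mathscr{H}_{\alpha,\phi}f(x_1,x_2)=\int_{\mathbb{R}^2}\frac{|\phi(t_1,t_2)|}{|t_1t_2|^{2\alpha+2}}f\left(\frac{x_1}{t_1},\frac{x_2}{t_2}\right)dt_1dt_2 .$$ *)

theory Defs
  imports "HOL-Analysis.Analysis"
begin

text \<open>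
  The plane is \<^typ>\<open>real \<times> real\<close> with Lebesgue measure \<^term>\<open>lebesgue\<close>.  Functions in the
  weighted spaces take values in a scalar field \<open>'a\<close> of class
  \<^class>\<open>real_normed_field\<close> and \<^class>\<open>banach\<close>, which covers the real and the complex case.
  They are not identified almost everywhere; the almost-everywhere identification is made
  explicit in \<open>bounded_Lp_operator\<close>.
\<close>

text \<open>Intended for exponents \<open>a > 0\<close> only.\<close>

definition ennpowr :: "ennreal \<Rightarrow> real \<Rightarrow> ennreal" where
  "ennpowr x a = (if x = \<infinity> then \<infinity> else ennreal (enn2real x powr a))"

definition weight_function :: "(real \<times> real \<Rightarrow> ennreal) \<Rightarrow> bool" where
  "weight_function v \<longleftrightarrow>
     v \<in> borel_measurable lebesgue \<and> (AE x in lebesgue. 0 < v x \<and> v x < \<infinity>)"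

definition Lp_norm ::
  "real \<Rightarrow> (real \<times> real \<Rightarrow> ennreal) \<Rightarrow> (real \<times> real \<Rightarrow> 'a::real_normed_field) \<Rightarrow> ennreal" where
  "Lp_norm p v f = ennpowr (\<integral>\<^sup>+x. ennreal (norm (f x) powr p) * v x \<partial>lebesgue) (1 / p)"

definition Lp_space ::
  "real \<Rightarrow> (real \<times> real \<Rightarrow> ennreal) \<Rightarrow> (real \<times> real \<Rightarrow> 'a::real_normed_field) set" where
  "Lp_space p v = {f \<in> borel_measurable lebesgue. Lp_norm p v f < \<infinity>}"

definition dunkl_hausdorff_integrand ::
  "real \<Rightarrow> (real \<times> real \<Rightarrow> 'a::real_normed_field) \<Rightarrow> (real \<times> real \<Rightarrow> 'a) \<Rightarrow>
     real \<times> real \<Rightarrow> real \<times> real \<Rightarrow> 'a" where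
  "dunkl_hausdorff_integrand \<alpha> \<phi> f = (\<lambda>(x1, x2) (t1, t2).
     (norm (\<phi> (t1, t2)) / \<bar>t1 * t2\<bar> powr (2 * \<alpha> + 2)) *\<^sub>R f (x1 / t1, x2 / t2))"

text \<open>
  The Bochner integral is \<open>0\<close> where the integrand is not integrable, so convergence
  of the defining integral has to be asserted separately.
\<close>

definition dunkl_hausdorff ::
  "real \<Rightarrow> (real \<times> real \<Rightarrow> 'a::{real_normed_field,banach,second_countable_topology}) \<Rightarrow>
     (real \<times> real \<Rightarrow> 'a) \<Rightarrow> real \<times> real \<Rightarrow> 'a" where
  "dunkl_hausdorff \<alpha> \<phi> f x = (\<integral>t. dunkl_hausdorff_integrand \<alpha> \<phi> f x t \<partial>lebesgue)"

text \<open>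
  The supremum is the pointwise one over the whole plane, in \<open>[0, \<infinity>]\<close>.  On the null set
  where numerator or denominator is \<open>0\<close> or \<open>\<infinity>\<close>, the quotient follows the conventions of
  \<^typ>\<open>ennreal\<close> (\<open>a / 0 = \<infinity>\<close> for \<open>a > 0\<close>, \<open>0 / 0 = 0\<close>, \<open>a / \<infinity> = 0\<close>).  As a function of \<open>t\<close>
  the supremum need not be measurable; \<open>nn_integral\<close> is then the lower integral.
\<close>

definition B_sup ::
  "real \<Rightarrow> real \<Rightarrow> (real \<times> real \<Rightarrow> 'a::real_normed_field) \<Rightarrow>
     (real \<times> real \<Rightarrow> ennreal) \<Rightarrow> (real \<times> real \<Rightarrow> ennreal) \<Rightarrow> ennreal" where
  "B_sup p \<alpha> \<phi> v w =
     (\<integral>\<^sup>+(t1, t2). ennreal (norm (\<phi> (t1, t2)) / \<bar>t1 * t2\<bar> powr (2 * \<alpha> + 2 - 1 / p)) *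
        ennpowr (SUP (y1, y2). v (t1 * y1, t2 * y2) / w (y1, y2)) (1 / p) \<partial>lebesgue)"

text \<open>
  A bounded linear operator from \<open>L\<^sup>p\<^sub>w\<close> to \<open>L\<^sup>p\<^sub>v\<close>, given on representatives: it respects
  almost-everywhere equality and is linear up to null sets.
\<close>

definition bounded_Lp_operator ::
  "real \<Rightarrow> (real \<times> real \<Rightarrow> ennreal) \<Rightarrow> (real \<times> real \<Rightarrow> ennreal) \<Rightarrow>
     ((real \<times> real \<Rightarrow> 'a::real_normed_field) \<Rightarrow> real \<times> real \<Rightarrow> 'a) \<Rightarrow> bool" where
  "bounded_Lp_operator p w v T \<longleftrightarrow>
     (\<forall>f \<in> Lp_space p w. T f \<in> Lp_space p v) \<and>
     (\<forall>f \<in> Lp_space p w. \<forall>g \<in> Lp_space p w.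
        (AE x in lebesgue. f x = g x) \<longrightarrow> (AE x in lebesgue. T f x = T g x)) \<and>
     (\<forall>f \<in> Lp_space p w. \<forall>g \<in> Lp_space p w.
        AE x in lebesgue. T (\<lambda>y. f y + g y) x = T f x + T g x) \<and>
     (\<forall>c. \<forall>f \<in> Lp_space p w. AE x in lebesgue. T (\<lambda>y. c * f y) x = c * T f x) \<and>
     (\<exists>C::real. 0 \<le> C \<and> (\<forall>f \<in> Lp_space p w. Lp_norm p v (T f) \<le> ennreal C * Lp_norm p w f))"

end

theory Submission
  imports Defs
begin

text \<open>
  Dominate the operator pointwise by the integral of \<open>k t * norm (f (x / t))\<close> over \<open>t\<close>, where
  \<open>k t = norm (\<phi> t) / \<bar>t\<^sub>1 t\<^sub>2\<bar>\<^bsup>2\<alpha>+2\<^esup>\<close> and products and quotients of points are taken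
  coordinatewise.  Minkowski's integral inequality (\<open>Minkowski_integral_inequality\<close>) bounds the
  norm of this majorant in \<open>L\<^sup>p\<^sub>v\<close> by the integral over \<open>t\<close> of \<open>k t\<close> times the norm of the dilate
  \<open>x \<mapsto> f (x / t)\<close>.  The substitution \<open>x = t y\<close> shows that the \<open>p\<close>-th power of the latter is
  \<open>\<bar>t\<^sub>1 t\<^sub>2\<bar>\<close> times the integral of \<open>norm (f y)\<^sup>p v (t y)\<close>, and bounding \<open>v (t y)\<close> by
  \<open>w y\<close> times the supremum of \<open>v (t y) / w y\<close> (\<open>nn_integral_dilated_weight_le\<close>) leaves
  exactly the integrand of \<open>B_sup\<close> times the norm of \<open>f\<close> in \<open>L\<^sup>p\<^sub>w\<close>.

  The supremum need not be measurable in \<open>t\<close>, so \<open>B_sup\<close> is a lower integral.  This does no harm: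
  the weighted norm of the dilate is measurable in \<open>t\<close> by Tonelli, and it is this
  measurable function that lies below the integrand of \<open>B_sup\<close>, up to the constant factor
  contributed by \<open>f\<close>.  The estimate is \<open>dunkl_hausdorff_majorant_bound\<close>.

  Since \<open>v\<close> is positive almost everywhere, the estimate also makes the majorant finite almost
  everywhere.  So the defining integral converges for almost every \<open>x\<close>
  (\<open>dunkl_hausdorff_well_defined\<close>), and linearity is that of the Bochner integral.  Invariance under
  changes of \<open>f\<close> on null sets holds because dilations preserve null sets
  (\<open>AE_dunkl_hausdorff_integrand_cong\<close>).
\<close>

section \<open>Powers of extended nonnegative reals\<close>

lemma ennpowr_ennreal: "0 \<le> r \<Longrightarrow> ennpowr (ennreal r) a = ennreal (r powr a)"
  by (simp add: ennpowr_def)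

lemma ennpowr_top [simp]: "ennpowr top a = top"
  by (simp add: ennpowr_def)

lemma ennpowr_zero [simp]: "ennpowr 0 a = 0"
  by (simp add: ennpowr_def)

lemma ennpowr_eq_0_iff [simp]: "ennpowr x a = 0 \<longleftrightarrow> x = 0"
  by (cases x) (auto simp: ennpowr_ennreal ennreal_eq_0_iff)

lemma ennpowr_eq_top_iff [simp]: "ennpowr x a = top \<longleftrightarrow> x = top"
  by (simp add: ennpowr_def)

lemma ennpowr_less_top_iff [simp]: "ennpowr x a < top \<longleftrightarrow> x < top"
  by (simp flip: less_top)

lemma ennpowr_mono: "0 < a \<Longrightarrow> x \<le> y \<Longrightarrow> ennpowr x a \<le> ennpowr y a"
  by (cases x; cases y) (auto simp: ennpowr_ennreal top_unique intro!: powr_mono2 ennreal_leI)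

lemma ennpowr_mult: "ennpowr (x * y) a = ennpowr x a * ennpowr y a"
proof (cases "x = top \<or> y = top")
  case True
  then show ?thesis by (auto simp: ennreal_mult_top ennreal_top_mult)
next
  case False
  then obtain r s where "x = ennreal r" "0 \<le> r" "y = ennreal s" "0 \<le> s"
    by (metis ennreal_cases)
  then show ?thesis
    by (simp add: ennpowr_ennreal powr_mult flip: ennreal_mult)
qed

lemma ennpowr_ennpowr: "ennpowr (ennpowr x a) b = ennpowr x (a * b)"
  by (cases x) (auto simp: ennpowr_ennreal powr_powr)

lemma ennpowr_one [simp]: "ennpowr x 1 = x"
  by (cases x) (auto simp: ennpowr_ennreal)

lemma borel_measurable_ennpowr [measurable (raw)]:
  assumes [measurable]: "f \<in> borel_measurable M"
  shows "(\<lambda>x. ennpowr (f x) a) \<in> borel_measurable M"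
  unfolding ennpowr_def by measurable

section \<open>Minkowski's integral inequality\<close>

text \<open>
  Young's inequality for the factorisation \<open>x = (x s\<^bsup>-1/q\<^esup>) s\<^bsup>1/q\<^esup>\<close>, where \<open>q\<close> is the
  exponent conjugate to \<open>p\<close>.  Geometrically, the concave \<open>p\<close>-th root lies below its
  tangent at \<open>s\<^sup>p\<close>, evaluated at \<open>x\<^sup>p\<close>, with equality at \<open>x = s\<close>.  Being affine in
  \<open>x\<^sup>p\<close>, it can be integrated term by term, and \<open>s\<close> can be chosen afterwards.
\<close>

lemma Young_ennreal:
  assumes p: "1 < p" and s: "0 < s"
  shows "x \<le> ennreal (s powr (1 - p) / p) * ennpowr x p + ennreal ((1 - 1 / p) * s)"
proof (cases x)
  case (real r)
  define q where "q = p / (p - 1)"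
  have q: "1 < q" "1 / p + 1 / q = 1" using p by (auto simp: q_def field_simps)
  have "r = (r * s powr (- (1 / q))) * s powr (1 / q)"
    using s by (simp add: mult.assoc flip: powr_add)
  also have "\<dots> \<le> (r * s powr (- (1 / q))) powr p / p + (s powr (1 / q)) powr q / q"
    using p q real s by (intro Youngs_inequality) auto
  also have "(s powr (1 / q)) powr q / q = (1 - 1 / p) * s"
  proof -
    have "1 / q = 1 - 1 / p" using q by simp
    have "(s powr (1 / q)) powr q / q = s * (1 / q)" using q s by (simp add: powr_powr)
    then show ?thesis unfolding \<open>1 / q = 1 - 1 / p\<close> by simp
  qed
  also have "(r * s powr (- (1 / q))) powr p = s powr (1 - p) * r powr p"
  proof -
    have "- (1 / q) * p = 1 - p" using p by (simp add: q_def field_simps)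
    then show ?thesis using real s by (simp add: powr_mult powr_powr)
  qed
  finally have "r \<le> s powr (1 - p) / p * r powr p + (1 - 1 / p) * s" by simp
  then have "ennreal r \<le> ennreal (s powr (1 - p) / p * r powr p + (1 - 1 / p) * s)"
    by (rule ennreal_leI)
  also have "\<dots> = ennreal (s powr (1 - p) / p) * ennpowr x p + ennreal ((1 - 1 / p) * s)"
    using real p s by (subst ennreal_plus) (auto simp: ennpowr_ennreal simp flip: ennreal_mult)
  finally show ?thesis using real by simp
next
  case top
  then show ?thesis using p s by (simp add: ennreal_mult_top)
qed

text \<open>
  Jensen's inequality for the probability density \<open>c / B\<close>, multiplied by \<open>B\<^sup>p\<close>.  No
  integrability of \<open>g\<close> is available, so instead of an appeal to convexity at the mean of \<open>g\<close>,
  which may be infinite, the affine bound of Young is integrated against \<open>c\<close>.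
\<close>

lemma weighted_Jensen_ennpowr:
  assumes p: "1 < p" and [measurable]: "g \<in> borel_measurable M" "c \<in> borel_measurable M"
    and B: "(\<integral>\<^sup>+t. c t \<partial>M) = ennreal B" "0 < B"
  shows "ennpowr (\<integral>\<^sup>+t. g t * c t \<partial>M) p
     \<le> ennreal (B powr (p - 1)) * (\<integral>\<^sup>+t. ennpowr (g t) p * c t \<partial>M)"
proof (cases "\<integral>\<^sup>+t. ennpowr (g t) p * c t \<partial>M")
  case top
  then show ?thesis using B by (simp add: ennreal_mult_top)
next
  case (real I)
  show ?thesis
  proof (cases "I = 0")
    case True
    with real have "AE t in M. ennpowr (g t) p * c t = 0"
      by (simp add: nn_integral_0_iff_AE)
    then have "AE t in M. g t * c t = 0" by eventually_elim auto
    then have "(\<integral>\<^sup>+t. g t * c t \<partial>M) = 0" by (simp add: nn_integral_0_iff_AE)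
    then show ?thesis by simp
  next
    case False
    with real have I: "0 < I" by simp
    \<comment> \<open>The \<open>L\<^sup>p\<close> mean of \<open>g\<close>: this value of \<open>s\<close> minimises the integrated Young bound.\<close>
    define s where "s = (I / B) powr (1 / p)"
    have s: "0 < s" using I B by (simp add: s_def)
    have sp: "s powr p = I / B" using I B p by (simp add: s_def powr_powr)
    let ?a = "s powr (1 - p) / p" and ?b = "(1 - 1 / p) * s"
    have "(\<integral>\<^sup>+t. g t * c t \<partial>M)
        \<le> (\<integral>\<^sup>+t. ennreal ?a * (ennpowr (g t) p * c t) + ennreal ?b * c t \<partial>M)"
    proof (rule nn_integral_mono)
      fix t
      show "g t * c t \<le> ennreal ?a * (ennpowr (g t) p * c t) + ennreal ?b * c t"
        using mult_right_mono[OF Young_ennreal[OF p s, of "g t"], of "c t"]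
        by (simp add: distrib_right mult.assoc)
    qed
    also have "\<dots> = ennreal ?a * ennreal I + ennreal ?b * ennreal B"
      using real B by (simp add: nn_integral_add nn_integral_cmult)
    also have "\<dots> = ennreal (?a * I + ?b * B)"
      using p s B I by (subst ennreal_plus) (auto simp flip: ennreal_mult)
    also have "?a * I + ?b * B = B * s"
    proof -
      have "s powr (1 - p) * I = B * s"
        using sp s B by (simp add: powr_diff field_simps)
      then show ?thesis using p by (simp add: field_simps)
    qed
    finally have "ennpowr (\<integral>\<^sup>+t. g t * c t \<partial>M) p \<le> ennpowr (ennreal (B * s)) p"
      using p by (intro ennpowr_mono) auto
    also have "\<dots> = ennreal (B powr (p - 1) * I)"
      using B s by (simp add: ennpowr_ennreal powr_mult powr_diff sp)
    finally show ?thesis using real B by (simp add: ennreal_mult)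
  qed
qed

text \<open>
  The norm of an integral is at most the integral of the norms.  Write \<open>n t\<close> for the
  \<open>L\<^sup>p\<close> norm of the slice \<open>h (\<cdot>, t)\<close> and \<open>B\<close> for the integral of \<open>n\<close>.  Jensen's inequality
  for the weight \<open>n\<close>, applied to \<open>h / n\<close>, bounds the \<open>p\<close>-th power of the inner integral by
  \<open>B\<^bsup>p-1\<^esup>\<close> times the integral of \<open>(h / n)\<^sup>p n\<close> in \<open>t\<close>.  By Tonelli that quantity can be
  integrated in \<open>x\<close> first, which turns \<open>(h / n)\<^sup>p n\<close> into \<open>n\<close> because the slices of \<open>h / n\<close> are
  normalised; what remains is \<open>B\<^bsup>p-1\<^esup> B\<close>.
\<close>

proposition Minkowski_integral_inequality:
  fixes h :: "'b \<Rightarrow> 'c \<Rightarrow> ennreal"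
  assumes "sigma_finite_measure M" "sigma_finite_measure N" and p: "1 < p"
    and h [measurable]: "case_prod h \<in> borel_measurable (M \<Otimes>\<^sub>M N)"
  shows "(\<integral>\<^sup>+x. ennpowr (\<integral>\<^sup>+t. h x t \<partial>N) p \<partial>M)
     \<le> ennpowr (\<integral>\<^sup>+t. ennpowr (\<integral>\<^sup>+x. ennpowr (h x t) p \<partial>M) (1 / p) \<partial>N) p"
proof -
  interpret M: sigma_finite_measure M by fact
  interpret N: sigma_finite_measure N by fact
  interpret pair_sigma_finite M N ..
  have [measurable]: "(\<lambda>(t, x). h x t) \<in> borel_measurable (N \<Otimes>\<^sub>M M)"
    using measurable_pair_swap[OF h] by (simp add: split_beta')
  define n where "n t = ennpowr (\<integral>\<^sup>+x. ennpowr (h x t) p \<partial>M) (1 / p)" for t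
  have [measurable]: "n \<in> borel_measurable N" unfolding n_def by measurable
  show ?thesis
  proof (cases "\<integral>\<^sup>+t. n t \<partial>N")
    case top
    then show ?thesis by (simp flip: n_def)
  next
    case (real B)
    have n_fin: "AE t in N. n t \<noteq> top"
      using real nn_integral_PInf_AE[of n N] by simp
    \<comment> \<open>Dividing by \<open>n t\<close> loses nothing: where \<open>n t = 0\<close>, the slice itself vanishes almost everywhere.\<close>
    have "AE t in N. AE x in M. h x t = h x t / n t * n t"
      using n_fin AE_space
    proof eventually_elim
      case (elim t)
      then have [measurable]: "(\<lambda>x. h x t) \<in> borel_measurable M" by measurable
      show ?case
      proof (cases "n t = 0")
        case True
        then have "(\<integral>\<^sup>+x. ennpowr (h x t) p \<partial>M) = 0" by (simp add: n_def)
        then have "AE x in M. ennpowr (h x t) p = 0"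
          by (subst (asm) nn_integral_0_iff_AE) auto
        then show ?thesis by eventually_elim simp
      next
        case False
        then show ?thesis using elim
          by (intro AE_I2)
            (metis ennreal_divide_times ennreal_times_divide mult_divide_eq_ennreal)
      qed
    qed
    then have eq: "AE x in M. AE t in N. h x t = h x t / n t * n t"
      by (subst AE_commute) auto
    show ?thesis
    proof (cases "B = 0")
      case True
      then have "AE t in N. n t = 0" using real by (simp add: nn_integral_0_iff_AE)
      have "AE x in M. ennpowr (\<integral>\<^sup>+t. h x t \<partial>N) p = 0"
        using eq
      proof eventually_elim
        case (elim x)
        with \<open>AE t in N. n t = 0\<close> have "AE t in N. h x t = 0"
          by eventually_elim simp
        then have "(\<integral>\<^sup>+t. h x t \<partial>N) = (\<integral>\<^sup>+t. 0 \<partial>N)" by (intro nn_integral_cong_AE) auto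
        then show ?case by simp
      qed
      then have "(\<integral>\<^sup>+x. ennpowr (\<integral>\<^sup>+t. h x t \<partial>N) p \<partial>M) = 0"
        by (subst nn_integral_0_iff_AE) auto
      then show ?thesis by simp
    next
      case False
      with real have B: "0 < B" by simp
      have "(\<integral>\<^sup>+x. ennpowr (\<integral>\<^sup>+t. h x t \<partial>N) p \<partial>M)
          \<le> (\<integral>\<^sup>+x. ennreal (B powr (p - 1)) * (\<integral>\<^sup>+t. ennpowr (h x t / n t) p * n t \<partial>N) \<partial>M)"
      proof (rule nn_integral_mono_AE)
        show "AE x in M. ennpowr (\<integral>\<^sup>+t. h x t \<partial>N) p
            \<le> ennreal (B powr (p - 1)) * (\<integral>\<^sup>+t. ennpowr (h x t / n t) p * n t \<partial>N)"
          using eq AE_space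
        proof eventually_elim
          case (elim x)
          then have [measurable]: "h x \<in> borel_measurable N" by measurable
          from elim have "(\<integral>\<^sup>+t. h x t \<partial>N) = (\<integral>\<^sup>+t. h x t / n t * n t \<partial>N)"
            by (intro nn_integral_cong_AE)
          then show ?case
            using weighted_Jensen_ennpowr[OF p, of "\<lambda>t. h x t / n t" N n B] real B by simp
        qed
      qed
      also have "\<dots> = ennreal (B powr (p - 1)) *
          (\<integral>\<^sup>+t. (\<integral>\<^sup>+x. ennpowr (h x t / n t) p * n t \<partial>M) \<partial>N)"
        by (subst nn_integral_cmult) (auto intro!: arg_cong2[where f = "(*)"] Fubini'[symmetric])
      also have "\<dots> \<le> ennreal (B powr (p - 1)) * (\<integral>\<^sup>+t. n t \<partial>N)"
      proof (intro mult_left_mono nn_integral_mono_AE)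
        show "AE t in N. (\<integral>\<^sup>+x. ennpowr (h x t / n t) p * n t \<partial>M) \<le> n t"
          using n_fin AE_space
        proof eventually_elim
          case (elim t)
          then have [measurable]: "(\<lambda>x. h x t) \<in> borel_measurable M" by measurable
          have "(\<integral>\<^sup>+x. ennpowr (h x t / n t) p * n t \<partial>M)
              = (\<integral>\<^sup>+x. ennpowr (h x t) p * (ennpowr (inverse (n t)) p * n t) \<partial>M)"
            by (simp add: divide_ennreal_def ennpowr_mult mult.assoc)
          also have "\<dots> = (\<integral>\<^sup>+x. ennpowr (h x t) p \<partial>M) * (ennpowr (inverse (n t)) p * n t)"
            by (rule nn_integral_multc) measurable
          also have "(\<integral>\<^sup>+x. ennpowr (h x t) p \<partial>M) = ennpowr (n t) p"
            using p by (simp add: n_def ennpowr_ennpowr)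
          also have "ennpowr (n t) p * (ennpowr (inverse (n t)) p * n t)
              = ennpowr (n t * inverse (n t)) p * n t"
            by (simp add: ennpowr_mult mult.assoc)
          also have "\<dots> \<le> n t"
          proof (cases "n t = 0")
            case False
            with elim have "n t * inverse (n t) = 1"
              by (auto simp: less_top intro: ennreal_divide_self simp flip: divide_ennreal_def)
            then show ?thesis using ennpowr_ennreal[of 1 p] by simp
          qed simp
          finally show ?case .
        qed
      qed simp
      also have "\<dots> = ennpowr (\<integral>\<^sup>+t. n t \<partial>N) p"
        using real B by (simp add: ennpowr_ennreal powr_diff flip: ennreal_mult)
      finally show ?thesis by (simp flip: n_def)
    qed
  qed
qed

section \<open>Functions measurable for a completed measure\<close>

text \<open>
  A value-by-value construction handles simple functions; the general case is a pointwise limit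
  of these.  The limit of the modified sequence is measurable everywhere because the target
  space is complete.
\<close>

lemma completion_ex_borel_measurable_banach:
  fixes f :: "'b \<Rightarrow> 'c::{banach, second_countable_topology}"
  assumes "f \<in> borel_measurable (completion M)"
  obtains g where "g \<in> borel_measurable M" "AE x in M. f x = g x"
proof -
  from borel_measurable_implies_sequence_metric[OF assms, of 0] obtain F where
    F: "\<And>i. simple_function (completion M) (F i)"
    "\<And>x. x \<in> space M \<Longrightarrow> (\<lambda>i. F i x) \<longlonglongrightarrow> f x"
    by auto
  have "\<forall>i. \<exists>f'. simple_function M f' \<and> (AE x in M. F i x = f' x)"
    using F(1) completion_ex_simple_function by blast
  then obtain G where G: "\<And>i. simple_function M (G i)" "\<And>i. AE x in M. F i x = G i x"
    by metis
  have [measurable]: "G i \<in> borel_measurable M" for i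
    by (rule borel_measurable_simple_function[OF G(1)])
  have "AE x in M. \<forall>i. F i x = G i x" using G(2) by (simp add: AE_all_countable)
  then have "AE x in M. f x = lim (\<lambda>i. G i x)"
    using AE_space
  proof eventually_elim
    case (elim x)
    then show ?case using F(2)[of x] by (simp add: limI)
  qed
  then show ?thesis by (intro that[of "\<lambda>x. lim (\<lambda>i. G i x)"]) auto
qed

lemma borel_measurable_completion_AE_eq:
  fixes f g :: "'b \<Rightarrow> 'c::topological_space"
  assumes g: "g \<in> borel_measurable M" and eq: "AE x in M. f x = g x"
  shows "f \<in> borel_measurable (completion M)"
proof (rule measurableI)
  fix A :: "'c set"
  assume A: "A \<in> sets borel"
  show "f -` A \<inter> space (completion M) \<in> sets (completion M)"
  proof (rule completion.in_sets_AE)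
    show "AE x in completion M. x \<in> g -` A \<inter> space M \<longleftrightarrow> x \<in> f -` A \<inter> space (completion M)"
      using AE_completion[OF eq] by eventually_elim simp
    show "g -` A \<inter> space M \<in> sets (completion M)"
      using measurable_sets[OF g A] by auto
  qed auto
qed simp

section \<open>Dilations of the plane\<close>

lemma borel_measurable_fst [measurable]:
  "fst \<in> borel_measurable (borel :: ('b::second_countable_topology \<times> 'c::second_countable_topology) measure)"
  unfolding borel_prod[symmetric] by (rule measurable_fst)

lemma borel_measurable_snd [measurable]:
  "snd \<in> borel_measurable (borel :: ('b::second_countable_topology \<times> 'c::second_countable_topology) measure)"
  unfolding borel_prod[symmetric] by (rule measurable_snd)

lemma nn_integral_lborel_scale2:
  fixes g :: "real \<times> real \<Rightarrow> ennreal"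
  assumes [measurable]: "g \<in> borel_measurable borel" and ab: "a \<noteq> 0" "b \<noteq> 0"
  shows "(\<integral>\<^sup>+y. g y \<partial>lborel) = ennreal \<bar>a * b\<bar> * (\<integral>\<^sup>+x. g (a * fst x, b * snd x) \<partial>lborel)"
proof -
  have g2: "(\<integral>\<^sup>+y. f y \<partial>lborel) = (\<integral>\<^sup>+x. \<integral>\<^sup>+y. f (x, y) \<partial>lborel \<partial>lborel)"
    if "f \<in> borel_measurable borel" for f :: "real \<times> real \<Rightarrow> ennreal"
    using that lborel.nn_integral_fst[of f lborel] by (simp add: lborel_prod)
  have "(\<integral>\<^sup>+y. g y \<partial>lborel) = (\<integral>\<^sup>+x. \<integral>\<^sup>+y. g (x, y) \<partial>lborel \<partial>lborel)"
    by (rule g2) measurable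
  also have "\<dots> = ennreal \<bar>a\<bar> * (\<integral>\<^sup>+x. \<integral>\<^sup>+y. g (a * x, y) \<partial>lborel \<partial>lborel)"
    using nn_integral_real_affine[of "\<lambda>x. \<integral>\<^sup>+y. g (x, y) \<partial>lborel" a 0] ab by simp
  also have "\<dots> = ennreal \<bar>a\<bar> *
      (\<integral>\<^sup>+x. ennreal \<bar>b\<bar> * (\<integral>\<^sup>+y. g (a * x, b * y) \<partial>lborel) \<partial>lborel)"
  proof -
    have "(\<integral>\<^sup>+y. g (a * x, y) \<partial>lborel) = ennreal \<bar>b\<bar> * (\<integral>\<^sup>+y. g (a * x, b * y) \<partial>lborel)" for x
      using nn_integral_real_affine[of "\<lambda>y. g (a * x, y)" b 0] ab by simp
    then show ?thesis by simp
  qed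
  also have "\<dots> = ennreal \<bar>a * b\<bar> * (\<integral>\<^sup>+x. \<integral>\<^sup>+y. g (a * x, b * y) \<partial>lborel \<partial>lborel)"
    by (simp add: nn_integral_cmult abs_mult ennreal_mult mult.assoc)
  finally show ?thesis by (subst g2) auto
qed

lemma AE_lborel_nonzero2: "AE t in (lborel :: (real \<times> real) measure). fst t \<noteq> 0 \<and> snd t \<noteq> 0"
proof -
  have "AE t in (lborel \<Otimes>\<^sub>M lborel :: (real \<times> real) measure). fst t \<noteq> 0 \<and> snd t \<noteq> 0"
  proof (rule lborel_pair.AE_pair_measure)
    show "AE x in lborel. AE y in lborel. fst (x, y) \<noteq> (0 :: real) \<and> snd (x, y) \<noteq> (0 :: real)"
      using AE_lborel_singleton[of "0 :: real"] by auto
  qed measurable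
  then show ?thesis unfolding lborel_prod .
qed

lemma AE_lborel_scale2:
  fixes P :: "real \<times> real \<Rightarrow> bool"
  assumes P: "AE y in lborel. P y" and ab: "a \<noteq> 0" "b \<noteq> 0"
  shows "AE x in lborel. P (a * fst x, b * snd x)"
proof -
  from P obtain N where N: "N \<in> null_sets lborel" "{y. \<not> P y} \<subseteq> N"
    by (auto simp: eventually_ae_filter)
  have [measurable]: "N \<in> sets borel" using N by auto
  have "0 = (\<integral>\<^sup>+y. indicator N y \<partial>lborel)" using N by (simp add: null_setsD1)
  also have "\<dots> = ennreal \<bar>a * b\<bar> * (\<integral>\<^sup>+x. indicator N (a * fst x, b * snd x) \<partial>lborel)"
    using ab by (intro nn_integral_lborel_scale2) auto
  finally have "(\<integral>\<^sup>+x. indicator N (a * fst x, b * snd x) \<partial>lborel) = (0 :: ennreal)"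
    using ab by simp
  then have "AE x in lborel. indicator N (a * fst x, b * snd x) = (0 :: ennreal)"
    by (subst (asm) nn_integral_0_iff_AE) auto
  then show ?thesis
    by eventually_elim (use N(2) in \<open>auto simp: indicator_eq_0_iff\<close>)
qed

text \<open>
  The order of the quantifiers is exchanged by Tonelli: for fixed \<open>t\<close> off the coordinate axes,
  \<open>x \<mapsto> x / t\<close> is a dilation and so pulls null sets back to null sets.  Consequently, changing \<open>f\<close>
  on a null set changes \<open>t \<mapsto> f (x / t)\<close> only on a null set, for almost every \<open>x\<close>.
\<close>

lemma AE_AE_lborel_quotient2:
  fixes P :: "real \<times> real \<Rightarrow> bool"
  assumes P: "AE y in lborel. P y"
  shows "AE x in lborel. AE t in lborel. P (fst x / fst t, snd x / snd t)"
proof -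
  from P obtain N where N: "N \<in> null_sets lborel" "{y. \<not> P y} \<subseteq> N"
    by (auto simp: eventually_ae_filter)
  have [measurable]: "N \<in> sets borel" using N by auto
  have "AE t in lborel. AE x in lborel. (fst x / fst t, snd x / snd t) \<notin> N"
    using AE_lborel_nonzero2
  proof eventually_elim
    case (elim t)
    then show ?case
      using AE_lborel_scale2[OF AE_not_in[OF N(1)], of "1 / fst t" "1 / snd t"] by simp
  qed
  then have "AE x in lborel. AE t in lborel. (fst x / fst t, snd x / snd t) \<notin> N"
  proof (subst lborel_pair.AE_commute)
    show "{x \<in> space (lborel \<Otimes>\<^sub>M lborel).
        (fst (fst x) / fst (snd x), snd (fst x) / snd (snd x)) \<notin> N} \<in> sets (lborel \<Otimes>\<^sub>M lborel)"
      by measurable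
  qed
  then show ?thesis
  proof eventually_elim
    case (elim x)
    then show ?case by eventually_elim (use N(2) in auto)
  qed
qed

section \<open>The Dunkl-Hausdorff operator\<close>

lemma dunkl_hausdorff_integrand_altdef:
  "dunkl_hausdorff_integrand \<alpha> \<phi> f x t =
     (norm (\<phi> t) / \<bar>fst t * snd t\<bar> powr (2 * \<alpha> + 2)) *\<^sub>R f (fst x / fst t, snd x / snd t)"
  by (simp add: dunkl_hausdorff_integrand_def split_beta)

lemma borel_measurable_dunkl_hausdorff_integrand [measurable]:
  fixes \<phi> f :: "real \<times> real \<Rightarrow> 'a::{real_normed_field, second_countable_topology}"
  assumes [measurable]: "\<phi> \<in> borel_measurable borel" "f \<in> borel_measurable borel"
  shows "(\<lambda>(x, t). dunkl_hausdorff_integrand \<alpha> \<phi> f x t) \<in> borel_measurable (borel \<Otimes>\<^sub>M borel)"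
  unfolding dunkl_hausdorff_integrand_altdef by measurable

lemma AE_dunkl_hausdorff_integrand_cong:
  assumes "AE t in lborel. \<phi> t = \<psi> t" "AE y in lborel. f y = g y"
  shows "AE x in lborel. AE t in lborel.
     dunkl_hausdorff_integrand \<alpha> \<phi> f x t = dunkl_hausdorff_integrand \<alpha> \<psi> g x t"
  using AE_AE_lborel_quotient2[OF assms(2)]
proof eventually_elim
  case (elim x)
  then show ?case
    using assms(1) by eventually_elim (simp add: dunkl_hausdorff_integrand_altdef)
qed

text \<open>
  The only place where the supremum in the hypothesis enters: off the null set where \<open>w\<close> is
  \<open>0\<close> or infinite, \<open>v (t y)\<close> is at most the supremum times \<open>w y\<close>.
\<close>

lemma nn_integral_dilated_weight_le:
  fixes f :: "real \<times> real \<Rightarrow> 'a::real_normed_field"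
  assumes w: "weight_function w" and f: "f \<in> borel_measurable lebesgue"
  shows "(\<integral>\<^sup>+y. ennreal (norm (f y) powr p) * v (a * fst y, b * snd y) \<partial>lborel)
     \<le> (SUP (y1, y2). v (a * y1, b * y2) / w (y1, y2)) *
         (\<integral>\<^sup>+y. ennreal (norm (f y) powr p) * w y \<partial>lebesgue)"
proof -
  define S where "S = (SUP (y1, y2). v (a * y1, b * y2) / w (y1, y2))"
  have [measurable]: "w \<in> borel_measurable lebesgue" and w_AE: "AE y in lborel. 0 < w y \<and> w y < top"
    using w by (auto simp: weight_function_def AE_completion_iff)
  note [measurable] = f
  have "(\<integral>\<^sup>+y. ennreal (norm (f y) powr p) * v (a * fst y, b * snd y) \<partial>lborel)
      \<le> (\<integral>\<^sup>+y. S * (ennreal (norm (f y) powr p) * w y) \<partial>lborel)"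
  proof (rule nn_integral_mono_AE)
    show "AE y in lborel. ennreal (norm (f y) powr p) * v (a * fst y, b * snd y)
        \<le> S * (ennreal (norm (f y) powr p) * w y)"
      using w_AE
    proof eventually_elim
      case (elim y)
      have "v (a * fst y, b * snd y) / w y \<le> S"
        unfolding S_def by (rule SUP_upper2[of y]) (auto simp: split_beta)
      then have "v (a * fst y, b * snd y) / w y * w y \<le> S * w y"
        by (rule mult_right_mono) simp
      moreover have "v (a * fst y, b * snd y) / w y * w y = v (a * fst y, b * snd y)"
        using elim
        by (metis ennreal_divide_times ennreal_times_divide less_irrefl mult_divide_eq_ennreal)
      ultimately have "v (a * fst y, b * snd y) \<le> S * w y" by simp
      then have "ennreal (norm (f y) powr p) * v (a * fst y, b * snd y)
          \<le> ennreal (norm (f y) powr p) * (S * w y)"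
        by (rule mult_left_mono) simp
      then show ?case by (simp only: mult.left_commute)
    qed
  qed
  also have "\<dots> = (\<integral>\<^sup>+y. S * (ennreal (norm (f y) powr p) * w y) \<partial>lebesgue)"
    by (simp add: nn_integral_completion)
  also have "\<dots> = S * (\<integral>\<^sup>+y. ennreal (norm (f y) powr p) * w y \<partial>lebesgue)"
    by (rule nn_integral_cmult) measurable
  finally show ?thesis by (simp add: S_def)
qed

lemma Lp_norm_powr:
  "0 < p \<Longrightarrow> ennpowr (Lp_norm p v f) p = (\<integral>\<^sup>+x. ennreal (norm (f x) powr p) * v x \<partial>lebesgue)"
  by (simp add: Lp_norm_def ennpowr_ennpowr)

text \<open>
  The quantitative core, stated for the integral of the norm of the integrand so that it makes
  sense before convergence is known.  Minkowski's inequality moves the weighted \<open>L\<^sup>p\<close> norm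
  inside the \<open>t\<close>-integral, and the substitution \<open>x = t y\<close> in the norm of each slice contributes
  the factor \<open>\<bar>t\<^sub>1 t\<^sub>2\<bar>\<^bsup>1/p\<^esup>\<close>, which accounts for the exponent in \<open>B_sup\<close>.  All the
  functions are first replaced by Borel versions, since Tonelli's theorem is applied to the
  product of the uncompleted measures.
\<close>

proposition dunkl_hausdorff_majorant_bound:
  fixes \<phi> f :: "real \<times> real \<Rightarrow> 'a::{real_normed_field, banach, second_countable_topology}"
  assumes p: "1 < p" and v: "weight_function v" and w: "weight_function w"
    and \<phi>: "\<phi> \<in> borel_measurable lebesgue" and f: "f \<in> Lp_space p w"
  shows "(\<integral>\<^sup>+x. ennpowr (\<integral>\<^sup>+t. norm (dunkl_hausdorff_integrand \<alpha> \<phi> f x t) \<partial>lebesgue) p * v x \<partial>lebesgue)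
     \<le> ennpowr (B_sup p \<alpha> \<phi> v w * Lp_norm p w f) p"
proof -
  have f_meas: "f \<in> borel_measurable lebesgue" and f_fin: "Lp_norm p w f < top"
    using f by (auto simp: Lp_space_def)
  obtain \<psi> where \<psi> [measurable]: "\<psi> \<in> borel_measurable lborel" and \<psi>_eq: "AE t in lborel. \<phi> t = \<psi> t"
    using completion_ex_borel_measurable_banach[OF \<phi>] .
  obtain g where g [measurable]: "g \<in> borel_measurable lborel" and g_eq: "AE y in lborel. f y = g y"
    using completion_ex_borel_measurable_banach[OF f_meas] .
  obtain u where u [measurable]: "u \<in> borel_measurable lborel" and u_eq: "AE y in lborel. v y = u y"
    using v completion_ex_borel_measurable[of v lborel] by (auto simp: weight_function_def)
  define c where "c = Lp_norm p w f"
  have c_fin: "c < top" using f_fin by (simp add: c_def)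
  \<comment> \<open>The weight is absorbed into the kernel, so that both measures in Minkowski's inequality are \<open>lborel\<close>.\<close>
  define H where "H x t = ennreal (norm (dunkl_hausdorff_integrand \<alpha> \<psi> g x t)) * ennpowr (u x) (1 / p)"
    for x t
  define n where "n t = ennpowr (\<integral>\<^sup>+x. ennpowr (H x t) p \<partial>lborel) (1 / p)" for t
  have H_meas [measurable]: "case_prod H \<in> borel_measurable (lborel \<Otimes>\<^sub>M lborel)"
    unfolding H_def by measurable
  have n_meas [measurable]: "n \<in> borel_measurable lborel"
    unfolding n_def by measurable
  define b where "b t = ennreal (norm (\<phi> t) / \<bar>fst t * snd t\<bar> powr (2 * \<alpha> + 2 - 1 / p)) *
      ennpowr (SUP (y1, y2). v (fst t * y1, snd t * y2) / w (y1, y2)) (1 / p)" for t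
  have B_b: "B_sup p \<alpha> \<phi> v w = (\<integral>\<^sup>+t. b t \<partial>lborel)"
    by (simp add: B_sup_def b_def nn_integral_completion split_beta')
  have n_le: "AE t in lborel. n t \<le> b t * c"
    using AE_lborel_nonzero2 \<psi>_eq
  proof eventually_elim
    case (elim t)
    then have t: "fst t \<noteq> 0" "snd t \<noteq> 0" by auto
    define K where "K = norm (\<phi> t) / \<bar>fst t * snd t\<bar> powr (2 * \<alpha> + 2)"
    define S where "S = (SUP (y1, y2). v (fst t * y1, snd t * y2) / w (y1, y2))"
    have K: "0 \<le> K" by (simp add: K_def)
    have "(\<integral>\<^sup>+x. ennpowr (H x t) p \<partial>lborel)
        = (\<integral>\<^sup>+x. ennreal (K powr p) *
            (ennreal (norm (g (fst x / fst t, snd x / snd t)) powr p) * u x) \<partial>lborel)"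
    proof (rule nn_integral_cong)
      fix x
      have "H x t = ennreal K * ennreal (norm (g (fst x / fst t, snd x / snd t))) * ennpowr (u x) (1 / p)"
        using elim K
        by (simp add: H_def dunkl_hausdorff_integrand_altdef K_def flip: ennreal_mult)
      then show "ennpowr (H x t) p = ennreal (K powr p) *
          (ennreal (norm (g (fst x / fst t, snd x / snd t)) powr p) * u x)"
        using p K by (simp add: ennpowr_mult ennpowr_ennpowr ennpowr_ennreal mult.assoc)
    qed
    also have "\<dots> = ennreal (K powr p) *
        (\<integral>\<^sup>+x. ennreal (norm (g (fst x / fst t, snd x / snd t)) powr p) * u x \<partial>lborel)"
      by (rule nn_integral_cmult) measurable
    also have "(\<integral>\<^sup>+x. ennreal (norm (g (fst x / fst t, snd x / snd t)) powr p) * u x \<partial>lborel)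
        = ennreal \<bar>fst t * snd t\<bar> *
            (\<integral>\<^sup>+y. ennreal (norm (g y) powr p) * u (fst t * fst y, snd t * snd y) \<partial>lborel)"
      by (subst nn_integral_lborel_scale2[of _ "fst t" "snd t"]) (use t in auto)
    also have "(\<integral>\<^sup>+y. ennreal (norm (g y) powr p) * u (fst t * fst y, snd t * snd y) \<partial>lborel)
        = (\<integral>\<^sup>+y. ennreal (norm (f y) powr p) * v (fst t * fst y, snd t * snd y) \<partial>lborel)"
    proof (rule nn_integral_cong_AE)
      show "AE y in lborel. ennreal (norm (g y) powr p) * u (fst t * fst y, snd t * snd y)
          = ennreal (norm (f y) powr p) * v (fst t * fst y, snd t * snd y)"
        using g_eq AE_lborel_scale2[OF u_eq t] by eventually_elim simp
    qed
    also have "\<dots> \<le> S * ennpowr c p"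
      unfolding S_def c_def Lp_norm_powr[OF less_trans[OF zero_less_one p]]
      by (rule nn_integral_dilated_weight_le[OF w f_meas])
    finally have "(\<integral>\<^sup>+x. ennpowr (H x t) p \<partial>lborel)
        \<le> ennreal (K powr p) * (ennreal \<bar>fst t * snd t\<bar> * (S * ennpowr c p))"
      by (simp add: mult_left_mono)
    then have "n t \<le> ennpowr (ennreal (K powr p) * (ennreal \<bar>fst t * snd t\<bar> * (S * ennpowr c p))) (1 / p)"
      unfolding n_def using p by (intro ennpowr_mono) auto
    also have "\<dots> = ennreal (K * \<bar>fst t * snd t\<bar> powr (1 / p)) * (ennpowr S (1 / p) * c)"
      using p K by (simp add: ennpowr_mult ennpowr_ennpowr ennpowr_ennreal powr_powr ennreal_mult mult.assoc)
    also have "K * \<bar>fst t * snd t\<bar> powr (1 / p)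
        = norm (\<phi> t) / \<bar>fst t * snd t\<bar> powr (2 * \<alpha> + 2 - 1 / p)"
      using t by (simp add: K_def powr_diff)
    finally show ?case by (simp add: b_def S_def mult.assoc)
  qed
  have int_n: "(\<integral>\<^sup>+t. n t \<partial>lborel) \<le> B_sup p \<alpha> \<phi> v w * c"
  proof (cases "c = 0")
    case True
    then have "AE t in lborel. n t = 0" using n_le by simp
    then have "(\<integral>\<^sup>+t. n t \<partial>lborel) = 0" by (simp add: nn_integral_0_iff_AE)
    then show ?thesis by simp
  next
    case False
    \<comment> \<open>The constant is pulled out on the side of \<open>n\<close>: unlike \<open>n\<close>, the function \<open>b\<close> need not be
      measurable, and for its lower integral monotonicity is used instead of homogeneity.\<close>
    have "(\<integral>\<^sup>+t. n t \<partial>lborel) = (\<integral>\<^sup>+t. n t / c * c \<partial>lborel)"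
    proof (rule nn_integral_cong)
      fix t
      show "n t = n t / c * c"
        using False c_fin
        by (metis ennreal_divide_times ennreal_times_divide less_irrefl mult_divide_eq_ennreal)
    qed
    also have "\<dots> = (\<integral>\<^sup>+t. n t / c \<partial>lborel) * c" by (rule nn_integral_multc) measurable
    also have "\<dots> \<le> (\<integral>\<^sup>+t. b t \<partial>lborel) * c"
    proof (intro mult_right_mono nn_integral_mono_AE)
      show "AE t in lborel. n t / c \<le> b t"
        using n_le
      proof eventually_elim
        case (elim t)
        then show ?case
          using divide_right_mono_ennreal[OF elim, of c] False c_fin
          by (simp add: mult_divide_eq_ennreal less_top)
      qed
    qed simp
    finally show ?thesis by (simp add: B_b)
  qed
  have "(\<integral>\<^sup>+x. ennpowr (\<integral>\<^sup>+t. norm (dunkl_hausdorff_integrand \<alpha> \<phi> f x t) \<partial>lebesgue) p * v x \<partial>lebesgue)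
      = (\<integral>\<^sup>+x. ennpowr (\<integral>\<^sup>+t. H x t \<partial>lborel) p \<partial>lborel)"
    unfolding nn_integral_completion
  proof (rule nn_integral_cong_AE)
    show "AE x in lborel. ennpowr (\<integral>\<^sup>+t. norm (dunkl_hausdorff_integrand \<alpha> \<phi> f x t) \<partial>lborel) p * v x
        = ennpowr (\<integral>\<^sup>+t. H x t \<partial>lborel) p"
      using AE_dunkl_hausdorff_integrand_cong[OF \<psi>_eq g_eq, of \<alpha>] u_eq
    proof eventually_elim
      case (elim x)
      have "(\<integral>\<^sup>+t. H x t \<partial>lborel)
          = (\<integral>\<^sup>+t. norm (dunkl_hausdorff_integrand \<alpha> \<psi> g x t) \<partial>lborel) * ennpowr (u x) (1 / p)"
        unfolding H_def by (rule nn_integral_multc) measurable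
      also have "(\<integral>\<^sup>+t. norm (dunkl_hausdorff_integrand \<alpha> \<psi> g x t) \<partial>lborel)
          = (\<integral>\<^sup>+t. norm (dunkl_hausdorff_integrand \<alpha> \<phi> f x t) \<partial>lborel)"
        by (rule nn_integral_cong_AE) (use elim(1) in \<open>eventually_elim, simp\<close>)
      finally show ?case using elim p by (simp add: ennpowr_mult ennpowr_ennpowr)
    qed
  qed
  also have "\<dots> \<le> ennpowr (\<integral>\<^sup>+t. n t \<partial>lborel) p"
    unfolding n_def
    by (rule Minkowski_integral_inequality[OF sigma_finite_lborel sigma_finite_lborel p H_meas])
  also have "\<dots> \<le> ennpowr (B_sup p \<alpha> \<phi> v w * c) p"
    using p int_n by (intro ennpowr_mono) auto
  finally show ?thesis by (simp add: c_def)
qed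

text \<open>
  The majorant has finite weighted \<open>L\<^sup>p\<close> norm and \<open>v\<close> is positive almost everywhere, so the
  majorant is finite almost everywhere.  At such points the integrand is integrable, and the
  integral agrees with the parametric integral of Borel versions, which is measurable by Fubini.
\<close>

lemma dunkl_hausdorff_well_defined:
  fixes \<phi> f :: "real \<times> real \<Rightarrow> 'a::{real_normed_field, banach, second_countable_topology}"
  assumes p: "1 < p" and v: "weight_function v" and w: "weight_function w"
    and \<phi>: "\<phi> \<in> borel_measurable lebesgue" and B: "B_sup p \<alpha> \<phi> v w < \<infinity>"
    and f: "f \<in> Lp_space p w"
  shows "AE x in lebesgue. integrable lebesgue (dunkl_hausdorff_integrand \<alpha> \<phi> f x)"
    and "dunkl_hausdorff \<alpha> \<phi> f \<in> borel_measurable lebesgue"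
proof -
  have f_meas: "f \<in> borel_measurable lebesgue" and f_fin: "Lp_norm p w f < top"
    using f by (auto simp: Lp_space_def)
  obtain \<psi> where \<psi> [measurable]: "\<psi> \<in> borel_measurable lborel" and \<psi>_eq: "AE t in lborel. \<phi> t = \<psi> t"
    using completion_ex_borel_measurable_banach[OF \<phi>] .
  obtain g where g [measurable]: "g \<in> borel_measurable lborel" and g_eq: "AE y in lborel. f y = g y"
    using completion_ex_borel_measurable_banach[OF f_meas] .
  obtain u where u [measurable]: "u \<in> borel_measurable lborel" and u_eq: "AE y in lborel. v y = u y"
    using v completion_ex_borel_measurable[of v lborel] by (auto simp: weight_function_def)
  have v_pos: "AE x in lborel. 0 < v x"
    using v by (auto simp: weight_function_def AE_completion_iff)
  have cong: "AE x in lborel. AE t in lborel.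
      dunkl_hausdorff_integrand \<alpha> \<phi> f x t = dunkl_hausdorff_integrand \<alpha> \<psi> g x t"
    by (rule AE_dunkl_hausdorff_integrand_cong[OF \<psi>_eq g_eq])
  let ?F = "\<lambda>x. \<integral>\<^sup>+t. norm (dunkl_hausdorff_integrand \<alpha> \<psi> g x t) \<partial>lborel"
  have "(\<integral>\<^sup>+x. ennpowr (?F x) p * u x \<partial>lborel) =
      (\<integral>\<^sup>+x. ennpowr (\<integral>\<^sup>+t. norm (dunkl_hausdorff_integrand \<alpha> \<phi> f x t) \<partial>lebesgue) p * v x \<partial>lebesgue)"
    unfolding nn_integral_completion
  proof (rule nn_integral_cong_AE)
    show "AE x in lborel. ennpowr (?F x) p * u x =
        ennpowr (\<integral>\<^sup>+t. norm (dunkl_hausdorff_integrand \<alpha> \<phi> f x t) \<partial>lborel) p * v x"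
      using cong u_eq
    proof eventually_elim
      case (elim x)
      have "?F x = (\<integral>\<^sup>+t. norm (dunkl_hausdorff_integrand \<alpha> \<phi> f x t) \<partial>lborel)"
        by (rule nn_integral_cong_AE) (use elim(1) in \<open>eventually_elim, simp\<close>)
      then show ?case using elim by simp
    qed
  qed
  also have "\<dots> \<le> ennpowr (B_sup p \<alpha> \<phi> v w * Lp_norm p w f) p"
    by (rule dunkl_hausdorff_majorant_bound[OF p v w \<phi> f])
  also have "\<dots> < top"
    using B f_fin by (simp add: ennreal_mult_less_top)
  finally have "AE x in lborel. ennpowr (?F x) p * u x \<noteq> top"
    using nn_integral_PInf_AE[of "\<lambda>x. ennpowr (?F x) p * u x" lborel] by simp
  then have F_fin: "AE x in lborel. ?F x < top"
    using u_eq v_pos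
    by eventually_elim (auto simp: less_top[symmetric] ennreal_mult_eq_top_iff)
  have meas: "dunkl_hausdorff_integrand \<alpha> \<psi> g x \<in> borel_measurable lborel" for x
    by measurable
  have integral_eq: "integrable lebesgue (dunkl_hausdorff_integrand \<alpha> \<phi> f x) \<and>
      dunkl_hausdorff \<alpha> \<phi> f x = (\<integral>t. dunkl_hausdorff_integrand \<alpha> \<psi> g x t \<partial>lborel)"
    if eq: "AE t in lborel. dunkl_hausdorff_integrand \<alpha> \<phi> f x t = dunkl_hausdorff_integrand \<alpha> \<psi> g x t"
      and fin: "?F x < top" for x
  proof -
    have m: "dunkl_hausdorff_integrand \<alpha> \<phi> f x \<in> borel_measurable lebesgue"
      by (rule borel_measurable_completion_AE_eq[OF meas eq])
    have "integrable lborel (dunkl_hausdorff_integrand \<alpha> \<psi> g x)"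
      using meas fin by (intro integrableI_bounded) auto
    then have i: "integrable lebesgue (dunkl_hausdorff_integrand \<alpha> \<psi> g x)"
      using meas by (simp add: integrable_completion)
    have eq': "AE t in lebesgue. dunkl_hausdorff_integrand \<alpha> \<psi> g x t = dunkl_hausdorff_integrand \<alpha> \<phi> f x t"
      using AE_completion[OF eq] by eventually_elim simp
    have "dunkl_hausdorff \<alpha> \<phi> f x = (\<integral>t. dunkl_hausdorff_integrand \<alpha> \<psi> g x t \<partial>lebesgue)"
      unfolding dunkl_hausdorff_def using m eq' i
      by (intro integral_cong_AE) (auto elim: eventually_mono)
    then show ?thesis
      using integrable_cong_AE_imp[OF i m eq'] integral_completion[OF meas] by simp
  qed
  have ae: "AE x in lborel. integrable lebesgue (dunkl_hausdorff_integrand \<alpha> \<phi> f x) \<and>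
      dunkl_hausdorff \<alpha> \<phi> f x = (\<integral>t. dunkl_hausdorff_integrand \<alpha> \<psi> g x t \<partial>lborel)"
    using cong F_fin by eventually_elim (rule integral_eq)
  then show "AE x in lebesgue. integrable lebesgue (dunkl_hausdorff_integrand \<alpha> \<phi> f x)"
    by (auto simp: AE_completion_iff)
  show "dunkl_hausdorff \<alpha> \<phi> f \<in> borel_measurable lebesgue"
  proof (rule borel_measurable_completion_AE_eq)
    show "(\<lambda>x. \<integral>t. dunkl_hausdorff_integrand \<alpha> \<psi> g x t \<partial>lborel) \<in> borel_measurable lborel"
      by measurable
    show "AE x in lborel. dunkl_hausdorff \<alpha> \<phi> f x = (\<integral>t. dunkl_hausdorff_integrand \<alpha> \<psi> g x t \<partial>lborel)"
      using ae by auto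
  qed
qed

lemma Lp_norm_dunkl_hausdorff_le:
  fixes \<phi> f :: "real \<times> real \<Rightarrow> 'a::{real_normed_field, banach, second_countable_topology}"
  assumes p: "1 < p" and v: "weight_function v" and w: "weight_function w"
    and \<phi>: "\<phi> \<in> borel_measurable lebesgue" and B: "B_sup p \<alpha> \<phi> v w < \<infinity>"
    and f: "f \<in> Lp_space p w"
  shows "Lp_norm p v (dunkl_hausdorff \<alpha> \<phi> f) \<le> B_sup p \<alpha> \<phi> v w * Lp_norm p w f"
proof -
  let ?F = "\<lambda>x. \<integral>\<^sup>+t. norm (dunkl_hausdorff_integrand \<alpha> \<phi> f x t) \<partial>lebesgue"
  have "(\<integral>\<^sup>+x. ennreal (norm (dunkl_hausdorff \<alpha> \<phi> f x) powr p) * v x \<partial>lebesgue)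
      \<le> (\<integral>\<^sup>+x. ennpowr (?F x) p * v x \<partial>lebesgue)"
  proof (rule nn_integral_mono_AE)
    show "AE x in lebesgue. ennreal (norm (dunkl_hausdorff \<alpha> \<phi> f x) powr p) * v x \<le> ennpowr (?F x) p * v x"
      using dunkl_hausdorff_well_defined(1)[OF p v w \<phi> B f]
    proof eventually_elim
      case (elim x)
      then have "ennreal (norm (dunkl_hausdorff \<alpha> \<phi> f x)) \<le> ?F x"
        unfolding dunkl_hausdorff_def by (rule integral_norm_bound_ennreal)
      then have "ennpowr (ennreal (norm (dunkl_hausdorff \<alpha> \<phi> f x))) p \<le> ennpowr (?F x) p"
        using p by (intro ennpowr_mono) auto
      then show ?case by (intro mult_right_mono) (simp_all add: ennpowr_ennreal)
    qed
  qed
  also have "\<dots> \<le> ennpowr (B_sup p \<alpha> \<phi> v w * Lp_norm p w f) p"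
    by (rule dunkl_hausdorff_majorant_bound[OF p v w \<phi> f])
  finally have "Lp_norm p v (dunkl_hausdorff \<alpha> \<phi> f)
      \<le> ennpowr (ennpowr (B_sup p \<alpha> \<phi> v w * Lp_norm p w f) p) (1 / p)"
    unfolding Lp_norm_def using p by (intro ennpowr_mono) auto
  then show ?thesis using p by (simp add: ennpowr_ennpowr)
qed

theorem theorem4p3:
  fixes p \<alpha> :: real
    and v w :: "real \<times> real \<Rightarrow> ennreal"
    and \<phi> :: "real \<times> real \<Rightarrow> 'a::{real_normed_field,banach,second_countable_topology}"
  assumes "1 < p"
    and "weight_function v" and "weight_function w"
    and "integrable lebesgue \<phi>"
    and "B_sup p \<alpha> \<phi> v w < \<infinity>"
  shows "(\<forall>f \<in> Lp_space p w. AE x in lebesgue.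
            integrable lebesgue (dunkl_hausdorff_integrand \<alpha> \<phi> f x)) \<and>
         bounded_Lp_operator p w v (dunkl_hausdorff \<alpha> \<phi>) \<and>
         (\<forall>f \<in> Lp_space p w.
            Lp_norm p v (dunkl_hausdorff \<alpha> \<phi> f) \<le> B_sup p \<alpha> \<phi> v w * Lp_norm p w f)"
proof -
  have \<phi>: "\<phi> \<in> borel_measurable lebesgue" using assms(4) by simp
  note int = dunkl_hausdorff_well_defined(1)[OF assms(1-3) \<phi> assms(5)]
    and meas = dunkl_hausdorff_well_defined(2)[OF assms(1-3) \<phi> assms(5)]
    and bound = Lp_norm_dunkl_hausdorff_le[OF assms(1-3) \<phi> assms(5)]
  have "bounded_Lp_operator p w v (dunkl_hausdorff \<alpha> \<phi>)"
    unfolding bounded_Lp_operator_def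
  proof (intro conjI ballI allI impI)
    fix f :: "real \<times> real \<Rightarrow> 'a"
    assume f: "f \<in> Lp_space p w"
    then have "B_sup p \<alpha> \<phi> v w * Lp_norm p w f < \<infinity>"
      using assms(5) by (simp add: Lp_space_def ennreal_mult_less_top)
    with bound[OF f] have "Lp_norm p v (dunkl_hausdorff \<alpha> \<phi> f) < \<infinity>" by (rule le_less_trans)
    then show "dunkl_hausdorff \<alpha> \<phi> f \<in> Lp_space p v" using meas[OF f] by (simp add: Lp_space_def)
  next
    fix f g :: "real \<times> real \<Rightarrow> 'a"
    assume f: "f \<in> Lp_space p w" and g: "g \<in> Lp_space p w" and eq: "AE x in lebesgue. f x = g x"
    have "AE x in lborel. AE t in lborel.
        dunkl_hausdorff_integrand \<alpha> \<phi> f x t = dunkl_hausdorff_integrand \<alpha> \<phi> g x t"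
      using eq by (intro AE_dunkl_hausdorff_integrand_cong) (auto simp: AE_completion_iff)
    then have "AE x in lebesgue. AE t in lebesgue.
        dunkl_hausdorff_integrand \<alpha> \<phi> f x t = dunkl_hausdorff_integrand \<alpha> \<phi> g x t"
      by (simp add: AE_completion_iff)
    with int[OF f] int[OF g] show "AE x in lebesgue. dunkl_hausdorff \<alpha> \<phi> f x = dunkl_hausdorff \<alpha> \<phi> g x"
    proof eventually_elim
      case (elim x)
      then show ?case unfolding dunkl_hausdorff_def by (intro integral_cong_AE) auto
    qed
  next
    fix f g :: "real \<times> real \<Rightarrow> 'a"
    assume f: "f \<in> Lp_space p w" and g: "g \<in> Lp_space p w"
    show "AE x in lebesgue. dunkl_hausdorff \<alpha> \<phi> (\<lambda>y. f y + g y) x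
        = dunkl_hausdorff \<alpha> \<phi> f x + dunkl_hausdorff \<alpha> \<phi> g x"
      using int[OF f] int[OF g]
    proof eventually_elim
      case (elim x)
      have "dunkl_hausdorff \<alpha> \<phi> (\<lambda>y. f y + g y) x
          = (\<integral>t. dunkl_hausdorff_integrand \<alpha> \<phi> f x t + dunkl_hausdorff_integrand \<alpha> \<phi> g x t \<partial>lebesgue)"
        by (simp add: dunkl_hausdorff_def dunkl_hausdorff_integrand_altdef scaleR_add_right)
      also have "\<dots> = dunkl_hausdorff \<alpha> \<phi> f x + dunkl_hausdorff \<alpha> \<phi> g x"
        unfolding dunkl_hausdorff_def using elim by (rule Bochner_Integration.integral_add)
      finally show ?case .
    qed
  next
    fix c :: 'a and f :: "real \<times> real \<Rightarrow> 'a"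
    assume f: "f \<in> Lp_space p w"
    show "AE x in lebesgue. dunkl_hausdorff \<alpha> \<phi> (\<lambda>y. c * f y) x = c * dunkl_hausdorff \<alpha> \<phi> f x"
      using int[OF f]
    proof eventually_elim
      case (elim x)
      have "dunkl_hausdorff \<alpha> \<phi> (\<lambda>y. c * f y) x
          = (\<integral>t. c * dunkl_hausdorff_integrand \<alpha> \<phi> f x t \<partial>lebesgue)"
        by (simp add: dunkl_hausdorff_def dunkl_hausdorff_integrand_altdef)
      also have "\<dots> = c * dunkl_hausdorff \<alpha> \<phi> f x"
        unfolding dunkl_hausdorff_def by (rule Bochner_Integration.integral_mult_right) (use elim in auto)
      finally show ?case .
    qed
  next
    have "ennreal (enn2real (B_sup p \<alpha> \<phi> v w)) = B_sup p \<alpha> \<phi> v w"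
      using assms(5) by simp
    then show "\<exists>C::real. 0 \<le> C \<and>
        (\<forall>f \<in> Lp_space p w. Lp_norm p v (dunkl_hausdorff \<alpha> \<phi> f) \<le> ennreal C * Lp_norm p w f)"
      using bound by (intro exI[of _ "enn2real (B_sup p \<alpha> \<phi> v w)"]) simp
  qed
  then show ?thesis using int bound by blast
qed

end
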